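(* Fix $\sigma>0$. For $\mathcal{E}>0$ let $\mathsf{C}(\mathcal{E})=\sup I(X;Y)$, where $Y=X+Z$ with $Z\sim\mathcal{N}(0,\sigma^2)$ independent of $X$, and the supremum is over all distributions of $X$ with $X\ge0$ a.s. and $\mathbb{E}[X]\le\mathcal{E}$. Then $$\lim_{\mathcal{E}\uparrow\infty}\left\{\mathsf{C}(\mathcal{E})-\log\frac{\mathcal{E}}{\sigma}\right\}=\frac12\log\frac{e}{2\pi},$$ $$\limsup_{\mathcal{E}\downarrow0}\frac{\mathsf{C}(\mathcal{E})}{\frac{\mathcal{E}}{\sigma}\sqrt{\log\frac{\sigma}{\mathcal{E}}}}\le2,\qquad\liminf_{\mathcal{E}\downarrow0}\frac{\mathsf{C}(\mathcal{E})}{\frac{\mathcal{E}}{\sigma}\sqrt{\log\frac{\sigma}{\mathcal{E}}}}\ge\frac{1}{\sqrt2}.$$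
   Context: Logarithms are natural (capacity in nats). The channel is the free-space optical intensity channel with nonnegative input, average-power constraint $\mathcal{E}$ only, and additive Gaussian noise of variance $\sigma^2$. *)

theory Defs
  imports "HOL-Probability.Probability"
begin

definition admissible_inputs :: "real \<Rightarrow> real measure set" where
  "admissible_inputs En = {P. prob_space P \<and> sets P = sets borel \<and>
      (AE x in P. 0 \<le> x) \<and> (\<integral>\<^sup>+ x. ennreal x \<partial>P) \<le> ennreal En}"

text \<open>Underlying probability space: (X, Z) with X ~ P independent of Z ~ N(0, sigma^2);
  the output is Y = X + Z.\<close>
definition chan_space :: "real \<Rightarrow> real measure \<Rightarrow> (real \<times> real) measure" where
  "chan_space \<sigma> P = P \<Otimes>\<^sub>M density lborel (normal_density 0 \<sigma>)"

definition chan_MI :: "real \<Rightarrow> real measure \<Rightarrow> real" where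
  "chan_MI \<sigma> P = prob_space.mutual_information (chan_space \<sigma> P) (exp 1) borel borel
      fst (\<lambda>\<omega>. fst \<omega> + snd \<omega>)"

definition capacity :: "real \<Rightarrow> real \<Rightarrow> real" where
  "capacity \<sigma> En = (SUP P \<in> admissible_inputs En. chan_MI \<sigma> P)"

end

(* The mutual information is the expectation of ln (phi(Z) / f(X + Z)), where phi is the noise
   density and f the output density.  By Gibbs' inequality, replacing f by any other density g
   can only increase this expectation, so every g yields an upper bound on the capacity.

   Large power: g is an exponential density of mean En with a light exponential tail on the
   negative axis.  Exponential inputs of mean En are asymptotically optimal, since
   f(y) <= exp(sigma^2 / (2 En^2)) exp(-y / En) / En.

   Small power: g is a mixture of the noise density and a Laplace density of weight En / sigma.
   For the lower bound the input takes the values 0 and A = sigma sqrt(2 ln(sigma / En)). *)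
theory Submission
  imports Defs "HOL-Real_Asymp.Real_Asymp"
begin

text \<open>The high-power constant is an entropy balance: the exponential law of mean
  \<open>En\<close> has entropy \<open>ln En + 1\<close>, the noise has entropy
  \<open>ln (2 * pi * \<sigma>\<^sup>2) / 2 + 1 / 2\<close>, and their difference minus
  \<open>ln (En / \<sigma>)\<close> is \<open>1 / 2 - ln (2 * pi) / 2\<close>. At low power put
  \<open>L = ln (\<sigma> / En)\<close>. The two-point input has mass \<open>En / A\<close> at
  \<open>A = \<sigma> * sqrt (2 * L)\<close> and divergence about \<open>L\<close> there, which
  yields about \<open>En / \<sigma> * sqrt (L / 2)\<close> and hence the constant
  \<open>1 / sqrt 2\<close>. The constant 2 is the slope of a line that dominates the divergence
  bounds of both mixture components. The obstacle is that mutual information is a Bochner integral,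
  with value 0 if the integrand is not integrable. For upper bounds this costs only a maximum with
  0. Lower bounds need genuine integrability, which is derived from a finite second moment; both
  concrete inputs have one.\<close>

section \<open>Product integrals and Gaussian moments\<close>

text \<open>Independence of input and noise enters here: the bounding functions \<open>B\<close>
  below are sums of such products. Over probability spaces, a constant factor 1 gives the
  one-variable marginals.\<close>

lemma (in pair_sigma_finite)
  fixes u :: "'a \<Rightarrow> real" and v :: "'b \<Rightarrow> real"
  assumes u: "integrable M1 u" and v: "integrable M2 v"
  shows integrable_fst_mult_snd: "integrable (M1 \<Otimes>\<^sub>M M2) (\<lambda>\<omega>. u (fst \<omega>) * v (snd \<omega>))"
    and integral_fst_mult_snd:
      "(\<integral>\<omega>. u (fst \<omega>) * v (snd \<omega>) \<partial>(M1 \<Otimes>\<^sub>M M2)) = (\<integral>x. u x \<partial>M1) * (\<integral>y. v y \<partial>M2)"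
proof -
  have [measurable]: "u \<in> borel_measurable M1" "v \<in> borel_measurable M2"
    using u v by auto
  show int: "integrable (M1 \<Otimes>\<^sub>M M2) (\<lambda>\<omega>. u (fst \<omega>) * v (snd \<omega>))"
  proof (rule Fubini_integrable)
    show "integrable M1 (\<lambda>x. \<integral>y. norm (u (fst (x, y)) * v (snd (x, y))) \<partial>M2)"
      using u by (simp add: abs_mult)
    show "AE x in M1. integrable M2 (\<lambda>y. u (fst (x, y)) * v (snd (x, y)))"
      using v by simp
  qed simp
  show "(\<integral>\<omega>. u (fst \<omega>) * v (snd \<omega>) \<partial>(M1 \<Otimes>\<^sub>M M2)) = (\<integral>x. u x \<partial>M1) * (\<integral>y. v y \<partial>M2)"
    using integral_fst'[OF int] by simp
qed

abbreviation noise :: "real \<Rightarrow> real measure" where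
  "noise \<sigma> \<equiv> density lborel (normal_density 0 \<sigma>)"

lemma ln_normal_density:
  assumes "0 < \<sigma>"
  shows "ln (normal_density \<mu> \<sigma> z) = - ln (2 * pi * \<sigma>\<^sup>2) / 2 - (z - \<mu>)\<^sup>2 / (2 * \<sigma>\<^sup>2)"
  using assms by (simp add: normal_density_def ln_mult ln_div ln_sqrt field_simps)

lemma normal_density_le:
  assumes "0 < \<sigma>"
  shows "normal_density \<mu> \<sigma> z \<le> 1 / sqrt (2 * pi * \<sigma>\<^sup>2)"
proof -
  have "exp (- (z - \<mu>)\<^sup>2 / (2 * \<sigma>\<^sup>2)) \<le> 1" by simp
  then show ?thesis
    unfolding normal_density_def by (intro mult_left_le) auto
qed

lemma normal_density_shift: "normal_density x \<sigma> (x + z) = normal_density 0 \<sigma> z"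
  by (simp add: normal_density_def)

lemma
  assumes "0 < \<sigma>"
  shows integrable_noise_sq: "integrable (noise \<sigma>) (\<lambda>z. z\<^sup>2)"
    and integral_noise_sq: "(\<integral>z. z\<^sup>2 \<partial>noise \<sigma>) = \<sigma>\<^sup>2"
    and integrable_noise: "integrable (noise \<sigma>) (\<lambda>z. z)"
    and integral_noise: "(\<integral>z. z \<partial>noise \<sigma>) = 0"
    and integrable_noise_abs: "integrable (noise \<sigma>) (\<lambda>z. \<bar>z\<bar>)"
    and integral_noise_abs_le: "(\<integral>z. \<bar>z\<bar> \<partial>noise \<sigma>) \<le> \<sigma>"
proof -
  interpret prob_space "noise \<sigma>" using assms by (rule prob_space_normal_density)
  show sq: "integrable (noise \<sigma>) (\<lambda>z. z\<^sup>2)"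
    using integrable_normal_moment[OF assms, of 0 2] by (subst integrable_real_density) auto
  show sqI: "(\<integral>z. z\<^sup>2 \<partial>noise \<sigma>) = \<sigma>\<^sup>2"
    using integral_normal_moment_even[OF assms, of 0 1] by (subst integral_real_density) auto
  show "integrable (noise \<sigma>) (\<lambda>z. z)"
    using integrable_normal_moment[OF assms, of 0 1] by (subst integrable_real_density) auto
  then show ab: "integrable (noise \<sigma>) (\<lambda>z. \<bar>z\<bar>)" by simp
  show "(\<integral>z. z \<partial>noise \<sigma>) = 0"
    using integral_normal_moment_odd[OF assms, of 0 0] by (subst integral_real_density) auto
  \<comment> \<open>AM-GM, scaled so that the mean of the right side is exactly
    \<open>\<sigma>\<close>. The resulting bound is not sharp, but it enters only lower-order terms
    in both limits.\<close>
  have "\<bar>z\<bar> \<le> (\<sigma> + z\<^sup>2 / \<sigma>) / 2" for z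
  proof -
    have "0 \<le> (\<bar>z\<bar> - \<sigma>)\<^sup>2" by simp
    then have "2 * \<sigma> * \<bar>z\<bar> \<le> \<sigma>\<^sup>2 + z\<^sup>2" by (simp add: power2_diff algebra_simps)
    then show ?thesis using assms by (simp add: field_simps power2_eq_square)
  qed
  then have "(\<integral>z. \<bar>z\<bar> \<partial>noise \<sigma>) \<le> (\<integral>z. (\<sigma> + z\<^sup>2 / \<sigma>) / 2 \<partial>noise \<sigma>)"
    using ab sq by (intro integral_mono) auto
  also have "\<dots> = \<sigma>"
    using sq sqI prob_space assms by (simp add: power2_eq_square)
  finally show "(\<integral>z. \<bar>z\<bar> \<partial>noise \<sigma>) \<le> \<sigma>" .
qed

section \<open>The channel with a fixed input law: output density, mutual information and its
  bounds\<close>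

locale awgn_input = prob_space P for P :: "real measure" +
  fixes \<sigma> :: real
  assumes sets_P [measurable_cong]: "sets P = sets borel" and sigma_pos: "0 < \<sigma>"
begin

lemma space_P [simp]: "space P = UNIV"
  using sets_eq_imp_space_eq[OF sets_P] by simp

sublocale Z: prob_space "noise \<sigma>"
  using sigma_pos by (rule prob_space_normal_density)

sublocale PZ: pair_prob_space P "noise \<sigma>" ..

definition out_density :: "real \<Rightarrow> real" where
  "out_density y = (\<integral>x. normal_density x \<sigma> y \<partial>P)"

lemma measurable_transition [measurable]:
  "(\<lambda>(x, y). normal_density x \<sigma> y) \<in> borel_measurable (P \<Otimes>\<^sub>M lborel)"
  unfolding normal_density_def by measurable

lemma measurable_transition_fst [measurable]: "(\<lambda>x. normal_density x \<sigma> y) \<in> borel_measurable P"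
  unfolding normal_density_def by measurable

lemma measurable_out_density [measurable]: "out_density \<in> borel_measurable borel"
proof -
  have "(\<lambda>(y, x). normal_density x \<sigma> y) \<in> borel_measurable (borel \<Otimes>\<^sub>M P)"
    unfolding normal_density_def by measurable
  then show ?thesis unfolding out_density_def[abs_def] by measurable
qed

lemma integrable_transition: "integrable P (\<lambda>x. normal_density x \<sigma> y)"
  using normal_density_le[OF sigma_pos]
  by (intro integrable_const_bound[where B="1 / sqrt (2 * pi * \<sigma>\<^sup>2)"]) auto

lemma out_density_le: "out_density y \<le> 1 / sqrt (2 * pi * \<sigma>\<^sup>2)"
  unfolding out_density_def
  using integral_mono[OF integrable_transition _ normal_density_le[OF sigma_pos]] prob_space by simp

text \<open>The inequality \<open>(y - x)\<^sup>2 \<le> 2 * y\<^sup>2 + 2 * x\<^sup>2\<close>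
  separates the transition density into a factor in \<open>y\<close> and a factor in
  \<open>x\<close>; the mean of the latter is positive for every input law. The Gaussian lower bound
  makes the logarithm of the output density at worst quadratic.\<close>

lemma out_density_ge:
  obtains K where "0 < K" "\<And>y. K * exp (- y\<^sup>2 / \<sigma>\<^sup>2) \<le> out_density y"
proof -
  define c where "c = (\<integral>x. exp (- x\<^sup>2 / \<sigma>\<^sup>2) \<partial>P)"
  have int: "integrable P (\<lambda>x. exp (- x\<^sup>2 / \<sigma>\<^sup>2))"
    by (intro integrable_const_bound[where B=1]) auto
  have "(\<integral>x. 0 \<partial>P) < c"
    unfolding c_def using int emeasure_space_1 by (intro integral_less_AE_space) auto
  then have "0 < c" by simp
  show ?thesis
  proof
    show "0 < c / sqrt (2 * pi * \<sigma>\<^sup>2)" using \<open>0 < c\<close> sigma_pos by simp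
    fix y
    have "exp (- y\<^sup>2 / \<sigma>\<^sup>2) / sqrt (2 * pi * \<sigma>\<^sup>2) * exp (- x\<^sup>2 / \<sigma>\<^sup>2) \<le> normal_density x \<sigma> y" for x
    proof -
      have "0 \<le> (y + x)\<^sup>2" by simp
      then have "(y - x)\<^sup>2 \<le> 2 * y\<^sup>2 + 2 * x\<^sup>2" by (simp add: power2_eq_square algebra_simps)
      then have "(y - x)\<^sup>2 / (2 * \<sigma>\<^sup>2) \<le> (2 * y\<^sup>2 + 2 * x\<^sup>2) / (2 * \<sigma>\<^sup>2)"
        by (rule divide_right_mono) simp
      then have "- y\<^sup>2 / \<sigma>\<^sup>2 + - x\<^sup>2 / \<sigma>\<^sup>2 \<le> - (y - x)\<^sup>2 / (2 * \<sigma>\<^sup>2)"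
        by (simp add: add_divide_distrib)
      then have "exp (- y\<^sup>2 / \<sigma>\<^sup>2) * exp (- x\<^sup>2 / \<sigma>\<^sup>2) \<le> exp (- (y - x)\<^sup>2 / (2 * \<sigma>\<^sup>2))"
        by (simp flip: exp_add)
      then show ?thesis unfolding normal_density_def
        by (simp add: divide_right_mono)
    qed
    from integral_mono[OF _ integrable_transition this]
    show "c / sqrt (2 * pi * \<sigma>\<^sup>2) * exp (- y\<^sup>2 / \<sigma>\<^sup>2) \<le> out_density y"
      using int by (simp add: out_density_def c_def mult.commute)
  qed
qed

lemma out_density_pos: "0 < out_density y"
  using out_density_ge by (metis exp_gt_zero less_le_trans mult_pos_pos)

text \<open>The reference measure for the input is its own law \<open>P\<close>, so that discrete
  inputs are covered: relative to it \<open>X\<close> has density 1, and the joint density is the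
  transition density. For fixed \<open>x\<close> the claim is translation invariance of Lebesgue
  measure.\<close>

lemma joint_distributed:
  "distributed (P \<Otimes>\<^sub>M noise \<sigma>) (P \<Otimes>\<^sub>M lborel) (\<lambda>\<omega>. (fst \<omega>, fst \<omega> + snd \<omega>))
     (\<lambda>\<omega>. normal_density (fst \<omega>) \<sigma> (snd \<omega>))"
  unfolding distributed_def
proof (intro conjI)
  have [measurable]: "(\<lambda>\<omega>. normal_density (fst \<omega>) \<sigma> (snd \<omega>)) \<in> borel_measurable (P \<Otimes>\<^sub>M lborel)"
    using measurable_transition by (simp add: case_prod_beta')
  show "(\<lambda>\<omega>. ennreal (normal_density (fst \<omega>) \<sigma> (snd \<omega>))) \<in> borel_measurable (P \<Otimes>\<^sub>M lborel)"
    by simp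
  show T: "(\<lambda>\<omega>. (fst \<omega>, fst \<omega> + snd \<omega>)) \<in> P \<Otimes>\<^sub>M noise \<sigma> \<rightarrow>\<^sub>M P \<Otimes>\<^sub>M lborel"
    by measurable
  show "distr (P \<Otimes>\<^sub>M noise \<sigma>) (P \<Otimes>\<^sub>M lborel) (\<lambda>\<omega>. (fst \<omega>, fst \<omega> + snd \<omega>)) =
    density (P \<Otimes>\<^sub>M lborel) (\<lambda>\<omega>. ennreal (normal_density (fst \<omega>) \<sigma> (snd \<omega>)))" (is "?L = ?R")
  proof (rule measure_eqI)
    fix A assume "A \<in> sets ?L"
    then have [measurable]: "A \<in> sets (P \<Otimes>\<^sub>M lborel)" by (simp only: sets_distr)
    have "emeasure ?L A = (\<integral>\<^sup>+\<omega>. indicator A \<omega> \<partial>?L)"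
      by (rule nn_integral_indicator[symmetric]) fact
    also have "\<dots> = (\<integral>\<^sup>+\<omega>. indicator A (fst \<omega>, fst \<omega> + snd \<omega>) \<partial>(P \<Otimes>\<^sub>M noise \<sigma>))"
      by (rule nn_integral_distr[OF T]) simp
    also have "\<dots> = (\<integral>\<^sup>+x. \<integral>\<^sup>+z. indicator A (x, x + z) \<partial>noise \<sigma> \<partial>P)"
    proof -
      have "(\<lambda>\<omega>. indicator A (fst \<omega>, fst \<omega> + snd \<omega>) :: ennreal) \<in> borel_measurable (P \<Otimes>\<^sub>M noise \<sigma>)"
        by (rule measurable_compose[OF T]) simp
      from Z.nn_integral_fst[OF this] show ?thesis unfolding fst_conv snd_conv ..
    qed
    also have "\<dots> = (\<integral>\<^sup>+x. \<integral>\<^sup>+y. ennreal (normal_density x \<sigma> y) * indicator A (x, y) \<partial>lborel \<partial>P)"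
    proof (intro nn_integral_cong)
      fix x assume "x \<in> space P"
      have "(\<lambda>y. indicator A (x, y) :: ennreal) \<in> borel_measurable borel" by measurable
      then show "(\<integral>\<^sup>+z. indicator A (x, x + z) \<partial>noise \<sigma>) =
        (\<integral>\<^sup>+y. ennreal (normal_density x \<sigma> y) * indicator A (x, y) \<partial>lborel)"
        by (subst nn_integral_real_affine[where c=1 and t=x])
           (simp_all add: nn_integral_density normal_density_shift)
    qed
    also have "\<dots> = emeasure ?R A"
    proof -
      have [measurable]: "(\<lambda>\<omega>. ennreal (normal_density (fst \<omega>) \<sigma> (snd \<omega>)) * indicator A \<omega>)
          \<in> borel_measurable (P \<Otimes>\<^sub>M lborel)"
        by measurable
      from lborel.nn_integral_fst[OF this] show ?thesis
        by (subst emeasure_density[OF _ \<open>A \<in> sets (P \<Otimes>\<^sub>M lborel)\<close>]) simp_all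
    qed
    finally show "emeasure ?L A = emeasure ?R A" .
  qed simp
qed

lemma output_distributed:
  "distributed (P \<Otimes>\<^sub>M noise \<sigma>) lborel (\<lambda>\<omega>. fst \<omega> + snd \<omega>) out_density"
proof -
  have "ennreal (out_density y) = (\<integral>\<^sup>+x. ennreal (normal_density x \<sigma> y) \<partial>P)" for y
    unfolding out_density_def by (simp add: nn_integral_eq_integral[OF integrable_transition])
  then show ?thesis
    using PZ.P.distr_marginal2[OF sigma_finite_measure_axioms lborel.sigma_finite_measure_axioms joint_distributed]
    by simp
qed

lemma input_distributed: "distributed (P \<Otimes>\<^sub>M noise \<sigma>) P fst (\<lambda>_. ennreal 1)"
  unfolding distributed_def
proof (intro conjI measure_eqI)
  fix A assume "A \<in> sets (distr (P \<Otimes>\<^sub>M noise \<sigma>) P fst)"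
  then have [measurable]: "A \<in> sets P" by simp
  have "emeasure (distr (P \<Otimes>\<^sub>M noise \<sigma>) P fst) A = emeasure (P \<Otimes>\<^sub>M noise \<sigma>) (A \<times> UNIV)"
    by (auto simp: emeasure_distr space_pair_measure intro!: arg_cong2[where f=emeasure])
  also have "\<dots> = emeasure P A"
    using Z.emeasure_space_1 by (subst Z.emeasure_pair_measure_Times) auto
  finally show "emeasure (distr (P \<Otimes>\<^sub>M noise \<sigma>) P fst) A = emeasure (density P (\<lambda>_. ennreal 1)) A"
    by (simp add: emeasure_density)
qed auto

lemma chan_MI_eq:
  "chan_MI \<sigma> P =
    (\<integral>\<omega>. ln (normal_density 0 \<sigma> (snd \<omega>) / out_density (fst \<omega> + snd \<omega>)) \<partial>(P \<Otimes>\<^sub>M noise \<sigma>))"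
proof -
  interpret I: information_space "P \<Otimes>\<^sub>M noise \<sigma>" "exp 1"
    by standard simp
  \<comment> \<open>The target spaces enter mutual information only through their sigma-algebras, so
    \<open>borel\<close> may be replaced by the reference measures \<open>P\<close> and
    \<open>lborel\<close>.\<close>
  have "chan_MI \<sigma> P = PZ.mutual_information (exp 1) P lborel fst (\<lambda>\<omega>. fst \<omega> + snd \<omega>)"
  proof -
    have "sets (borel \<Otimes>\<^sub>M borel) = sets (P \<Otimes>\<^sub>M lborel)"
      by (intro sets_pair_measure_cong) (simp_all add: sets_P)
    then have 1: "distr (P \<Otimes>\<^sub>M noise \<sigma>) (borel \<Otimes>\<^sub>M borel) X = distr (P \<Otimes>\<^sub>M noise \<sigma>) (P \<Otimes>\<^sub>M lborel) X" for X
      by (intro distr_cong) auto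
    have 2: "distr (P \<Otimes>\<^sub>M noise \<sigma>) borel fst = distr (P \<Otimes>\<^sub>M noise \<sigma>) P fst"
      by (intro distr_cong) (simp_all add: sets_P)
    have 3: "distr (P \<Otimes>\<^sub>M noise \<sigma>) borel (\<lambda>\<omega>. fst \<omega> + snd \<omega>) =
        distr (P \<Otimes>\<^sub>M noise \<sigma>) lborel (\<lambda>\<omega>. fst \<omega> + snd \<omega>)"
      by (intro distr_cong) simp_all
    show ?thesis
      unfolding chan_MI_def chan_space_def PZ.mutual_information_def 1 2 3 ..
  qed
  also have "\<dots> = (\<integral>\<omega>. normal_density (fst \<omega>) \<sigma> (snd \<omega>) *
      log (exp 1) (normal_density (fst \<omega>) \<sigma> (snd \<omega>) / (1 * out_density (snd \<omega>))) \<partial>(P \<Otimes>\<^sub>M lborel))"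
    using out_density_pos[THEN less_imp_le]
    by (intro I.mutual_information_distr input_distributed output_distributed joint_distributed)
       (auto intro: sigma_finite_measure_axioms lborel.sigma_finite_measure_axioms)
  \<comment> \<open>The joint density is absorbed again by returning from \<open>(X, Y)\<close> to
    \<open>(X, Z)\<close>; along \<open>y = x + z\<close> the transition density becomes the noise
    density at \<open>z\<close>.\<close>
  also have "\<dots> = (\<integral>\<omega>. (\<lambda>\<omega>. log (exp 1) (normal_density (fst \<omega>) \<sigma> (snd \<omega>) / (1 * out_density (snd \<omega>))))
      (fst \<omega>, fst \<omega> + snd \<omega>) \<partial>(P \<Otimes>\<^sub>M noise \<sigma>))"
  proof (rule distributed_integral[OF joint_distributed])
    have [measurable]: "(\<lambda>\<omega>. normal_density (fst \<omega>) \<sigma> (snd \<omega>)) \<in> borel_measurable (P \<Otimes>\<^sub>M lborel)"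
      using measurable_transition by (simp add: case_prod_beta')
    show "(\<lambda>\<omega>. log (exp 1) (normal_density (fst \<omega>) \<sigma> (snd \<omega>) / (1 * out_density (snd \<omega>))))
      \<in> borel_measurable (P \<Otimes>\<^sub>M lborel)" by measurable
  qed simp
  finally show ?thesis
    by (simp add: log_def normal_density_shift)
qed

text \<open>The value 0 covers the junk case of a non-integrable information density.\<close>

lemma chan_MI_le:
  assumes [measurable]: "g \<in> borel_measurable borel" and g_pos: "\<And>y. 0 < g y"
    and g_int: "(\<integral>\<^sup>+y. ennreal (g y) \<partial>lborel) \<le> 1"
    and B: "integrable (P \<Otimes>\<^sub>M noise \<sigma>) B"
    and le: "AE \<omega> in P \<Otimes>\<^sub>M noise \<sigma>. ln (normal_density 0 \<sigma> (snd \<omega>) / g (fst \<omega> + snd \<omega>)) \<le> B \<omega>"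
  shows "chan_MI \<sigma> P \<le> max 0 (\<integral>\<omega>. B \<omega> \<partial>(P \<Otimes>\<^sub>M noise \<sigma>))"
proof (cases "integrable (P \<Otimes>\<^sub>M noise \<sigma>)
    (\<lambda>\<omega>. ln (normal_density 0 \<sigma> (snd \<omega>) / out_density (fst \<omega> + snd \<omega>)))")
  case True
  have g: "integrable lborel g" "(\<integral>y. g y \<partial>lborel) \<le> 1"
  proof -
    show *: "integrable lborel g"
      using g_int g_pos by (intro integrableI_nonneg) (auto simp: less_imp_le intro: le_less_trans)
    show "(\<integral>y. g y \<partial>lborel) \<le> 1"
      using g_int g_pos nn_integral_eq_integral[OF *] by (simp add: less_imp_le)
  qed
  have eq: "out_density y * (g y / out_density y) = g y" for y
    using out_density_pos[of y] by simp
  have m: "(\<lambda>y. g y / out_density y) \<in> borel_measurable lborel" by measurable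
  have ratio: "integrable (P \<Otimes>\<^sub>M noise \<sigma>) (\<lambda>\<omega>. g (fst \<omega> + snd \<omega>) / out_density (fst \<omega> + snd \<omega>))"
    using distributed_integrable[OF output_distributed m] g(1) out_density_pos[THEN less_imp_le]
    unfolding eq by simp
  have ratioI: "(\<integral>\<omega>. g (fst \<omega> + snd \<omega>) / out_density (fst \<omega> + snd \<omega>) \<partial>(P \<Otimes>\<^sub>M noise \<sigma>)) \<le> 1"
    using distributed_integral[OF output_distributed m] g(2) out_density_pos[THEN less_imp_le]
    unfolding eq by simp
  \<comment> \<open>Gibbs' inequality in pointwise form: write
    \<open>ln (\<phi> / f) = ln (\<phi> / g) + ln (g / f)\<close> and apply
    \<open>ln r \<le> r - 1\<close> to the last term. The mean of \<open>g / f\<close> at the output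
    is the integral of \<open>g\<close>, at most 1.\<close>
  have "chan_MI \<sigma> P \<le> (\<integral>\<omega>. B \<omega> + (g (fst \<omega> + snd \<omega>) / out_density (fst \<omega> + snd \<omega>) - 1) \<partial>(P \<Otimes>\<^sub>M noise \<sigma>))"
    unfolding chan_MI_eq
  proof (rule integral_mono_AE[OF True])
    show "integrable (P \<Otimes>\<^sub>M noise \<sigma>) (\<lambda>\<omega>. B \<omega> + (g (fst \<omega> + snd \<omega>) / out_density (fst \<omega> + snd \<omega>) - 1))"
      using B ratio by simp
    show "AE \<omega> in P \<Otimes>\<^sub>M noise \<sigma>. ln (normal_density 0 \<sigma> (snd \<omega>) / out_density (fst \<omega> + snd \<omega>))
        \<le> B \<omega> + (g (fst \<omega> + snd \<omega>) / out_density (fst \<omega> + snd \<omega>) - 1)"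
      using le
    proof eventually_elim
      case (elim \<omega>)
      let ?y = "fst \<omega> + snd \<omega>"
      have p: "0 < g ?y" "0 < out_density ?y" "0 < normal_density 0 \<sigma> (snd \<omega>)"
        using g_pos out_density_pos normal_density_pos[OF sigma_pos] by auto
      have "ln (g ?y / out_density ?y) \<le> g ?y / out_density ?y - 1"
        using p by (intro ln_le_minus_one) auto
      then show ?case using elim p by (simp add: ln_div)
    qed
  qed
  also have "\<dots> \<le> (\<integral>\<omega>. B \<omega> \<partial>(P \<Otimes>\<^sub>M noise \<sigma>))"
    using B ratio ratioI PZ.P.prob_space by simp
  finally show ?thesis by simp
qed (simp add: chan_MI_eq not_integrable_integral_eq)

lemma
  fixes u :: "real \<Rightarrow> real"
  shows integrable_fst: "integrable P u \<Longrightarrow> integrable (P \<Otimes>\<^sub>M noise \<sigma>) (\<lambda>\<omega>. u (fst \<omega>))"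
  and integral_fst: "integrable P u \<Longrightarrow> (\<integral>\<omega>. u (fst \<omega>) \<partial>(P \<Otimes>\<^sub>M noise \<sigma>)) = (\<integral>x. u x \<partial>P)"
  and integrable_snd: "integrable (noise \<sigma>) u \<Longrightarrow> integrable (P \<Otimes>\<^sub>M noise \<sigma>) (\<lambda>\<omega>. u (snd \<omega>))"
  and integral_snd: "integrable (noise \<sigma>) u \<Longrightarrow> (\<integral>\<omega>. u (snd \<omega>) \<partial>(P \<Otimes>\<^sub>M noise \<sigma>)) = (\<integral>x. u x \<partial>noise \<sigma>)"
  using PZ.integrable_fst_mult_snd[of u "\<lambda>_. 1"] PZ.integral_fst_mult_snd[of u "\<lambda>_. 1"]
    PZ.integrable_fst_mult_snd[of "\<lambda>_. 1" u] PZ.integral_fst_mult_snd[of "\<lambda>_. 1" u] prob_space Z.prob_space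
  by simp_all

text \<open>The log output density lies between a quadratic and a constant, and the log noise
  density is quadratic, so squares of \<open>x\<close> and \<open>z\<close> dominate. This excludes
  the default value 0 of the integral, which could lie below a claimed lower bound.\<close>

lemma integrable_information_density:
  assumes sq: "integrable P (\<lambda>x. x\<^sup>2)"
  shows "integrable (P \<Otimes>\<^sub>M noise \<sigma>)
    (\<lambda>\<omega>. ln (normal_density 0 \<sigma> (snd \<omega>) / out_density (fst \<omega> + snd \<omega>)))"
proof -
  obtain K where K: "0 < K" "\<And>y. K * exp (- y\<^sup>2 / \<sigma>\<^sup>2) \<le> out_density y"
    using out_density_ge by blast
  define c where "c = - ln (2 * pi * \<sigma>\<^sup>2) / 2"
  have c: "ln (1 / sqrt (2 * pi * \<sigma>\<^sup>2)) = c"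
    using sigma_pos by (simp add: ln_div ln_sqrt c_def ln_mult field_simps)
  define B where "B \<omega> = \<bar>c - ln K\<bar> + 4 * (fst \<omega>)\<^sup>2 / \<sigma>\<^sup>2 + 4 * (snd \<omega>)\<^sup>2 / \<sigma>\<^sup>2" for \<omega> :: "real \<times> real"
  show ?thesis
  proof (rule Bochner_Integration.integrable_bound)
    show "integrable (P \<Otimes>\<^sub>M noise \<sigma>) B"
      unfolding B_def[abs_def]
      using integrable_fst[OF sq] integrable_snd[OF integrable_noise_sq[OF sigma_pos]] by simp
    show "AE \<omega> in P \<Otimes>\<^sub>M noise \<sigma>. norm (ln (normal_density 0 \<sigma> (snd \<omega>) / out_density (fst \<omega> + snd \<omega>))) \<le> norm (B \<omega>)"
    proof (rule AE_I2)
      fix \<omega> :: "real \<times> real"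
      obtain x z where w: "\<omega> = (x, z)" by fastforce
      note f = out_density_pos[of "x + z"]
      have phi: "ln (normal_density 0 \<sigma> z) = c - z\<^sup>2 / (2 * \<sigma>\<^sup>2)"
        using ln_normal_density[OF sigma_pos, of 0 z] by (simp add: c_def)
      have up: "ln (out_density (x + z)) \<le> c"
        using out_density_le[of "x + z"] f by (subst c[symmetric]) (intro ln_mono)
      have "ln (K * exp (- (x + z)\<^sup>2 / \<sigma>\<^sup>2)) \<le> ln (out_density (x + z))"
        using K f by (subst ln_le_cancel_iff) auto
      then have lo: "ln K - (x + z)\<^sup>2 / \<sigma>\<^sup>2 \<le> ln (out_density (x + z))"
        using K by (simp add: ln_mult)
      have "0 \<le> (x - z)\<^sup>2" by simp
      then have "(x + z)\<^sup>2 \<le> 2 * x\<^sup>2 + 2 * z\<^sup>2" by (simp add: power2_eq_square algebra_simps)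
      then have "(x + z)\<^sup>2 / \<sigma>\<^sup>2 \<le> (2 * x\<^sup>2 + 2 * z\<^sup>2) / \<sigma>\<^sup>2"
        by (rule divide_right_mono) simp
      then have q: "(x + z)\<^sup>2 / \<sigma>\<^sup>2 \<le> 2 * (x\<^sup>2 / \<sigma>\<^sup>2) + 2 * (z\<^sup>2 / \<sigma>\<^sup>2)"
        by (simp add: add_divide_distrib)
      have pos: "0 \<le> x\<^sup>2 / \<sigma>\<^sup>2" "0 \<le> z\<^sup>2 / \<sigma>\<^sup>2" by auto
      have eq: "ln (normal_density 0 \<sigma> z / out_density (x + z)) = c - (z\<^sup>2 / \<sigma>\<^sup>2) / 2 - ln (out_density (x + z))"
        using phi f normal_density_pos[OF sigma_pos, of 0 z] by (simp add: ln_div)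
      have "\<bar>ln (normal_density 0 \<sigma> z / out_density (x + z))\<bar> \<le> B (x, z)"
      proof -
        define a b where "a = x\<^sup>2 / \<sigma>\<^sup>2" and "b = z\<^sup>2 / \<sigma>\<^sup>2"
        show ?thesis
          using up lo q pos
          unfolding eq B_def fst_conv snd_conv times_divide_eq_right[symmetric] a_def[symmetric] b_def[symmetric]
          by linarith
      qed
      then show "norm (ln (normal_density 0 \<sigma> (snd \<omega>) / out_density (fst \<omega> + snd \<omega>))) \<le> norm (B \<omega>)"
        by (simp add: w)
    qed
  qed measurable
qed


lemma chan_MI_ge:
  assumes sq: "integrable P (\<lambda>x. x\<^sup>2)" and B: "integrable (P \<Otimes>\<^sub>M noise \<sigma>) B"
    and ge: "AE \<omega> in P \<Otimes>\<^sub>M noise \<sigma>.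
      B \<omega> \<le> ln (normal_density 0 \<sigma> (snd \<omega>) / out_density (fst \<omega> + snd \<omega>))"
  shows "(\<integral>\<omega>. B \<omega> \<partial>(P \<Otimes>\<^sub>M noise \<sigma>)) \<le> chan_MI \<sigma> P"
  unfolding chan_MI_eq using B integrable_information_density[OF sq] ge by (rule integral_mono_AE)

lemma AE_fst:
  assumes "AE x in P. Q x"
  shows "AE \<omega> in P \<Otimes>\<^sub>M noise \<sigma>. Q (fst \<omega>)"
proof (rule AE_distrD[of fst _ P])
  show "fst \<in> P \<Otimes>\<^sub>M noise \<sigma> \<rightarrow>\<^sub>M P" by simp
  have "distr (P \<Otimes>\<^sub>M noise \<sigma>) P fst = P"
    using distributed_distr_eq_density[OF input_distributed] by (simp add: density_1)
  then show "AE x in distr (P \<Otimes>\<^sub>M noise \<sigma>) P fst. Q x"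
    using assms by presburger
qed

end

section \<open>The two-sided exponential test density\<close>

text \<open>This mixes an exponential law of mean \<open>a\<close> and a reflected one of mean
  \<open>b\<close> with weights \<open>a / (a + b)\<close> and \<open>b / (a + b)\<close>, the
  weights that make the density continuous at 0. For \<open>a = b\<close> it is the Laplace
  density.\<close>

definition two_sided_exp :: "real \<Rightarrow> real \<Rightarrow> real \<Rightarrow> real" where
  "two_sided_exp a b y = exp (- max y 0 / a - max (- y) 0 / b) / (a + b)"

lemma two_sided_exp_measurable [measurable]: "two_sided_exp a b \<in> borel_measurable borel"
  unfolding two_sided_exp_def[abs_def] by measurable

lemma two_sided_exp_pos: "0 < a \<Longrightarrow> 0 < b \<Longrightarrow> 0 < two_sided_exp a b y"
  by (simp add: two_sided_exp_def)

lemma ln_two_sided_exp: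
  "0 < a \<Longrightarrow> 0 < b \<Longrightarrow> ln (two_sided_exp a b y) = - ln (a + b) - max y 0 / a - max (- y) 0 / b"
  by (simp add: two_sided_exp_def ln_div)

text \<open>As \<open>x\<close> is nonnegative, the negative part of \<open>x + z\<close> is at most
  \<open>\<bar>z\<bar>\<close>. The left tail is therefore charged to the noise alone, whatever the
  input.\<close>

lemma two_sided_exp_lower:
  assumes "0 < a" "0 < b" "0 \<le> x"
  shows "- ln (two_sided_exp a b (x + z)) \<le> ln (a + b) + (x + \<bar>z\<bar>) / a + \<bar>z\<bar> / b"
proof -
  have "max (x + z) 0 / a \<le> (x + \<bar>z\<bar>) / a" "max (- (x + z)) 0 / b \<le> \<bar>z\<bar> / b"
    using assms by (auto intro!: divide_right_mono)
  then show ?thesis using assms by (simp add: ln_two_sided_exp)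
qed

lemma nn_integral_exponential_density:
  "0 < l \<Longrightarrow> (\<integral>\<^sup>+y. ennreal (exponential_density l y) \<partial>lborel) = 1"
  using nn_integral_erlang_ith_moment[of l 0 0] by simp

lemma nn_integral_two_sided_exp:
  assumes a: "0 < a" and b: "0 < b"
  shows "(\<integral>\<^sup>+y. ennreal (two_sided_exp a b y) \<partial>lborel) \<le> 1"
proof -
  \<comment> \<open>Only an inequality: at \<open>y = 0\<close> both exponential densities are
    positive and the right side counts twice. Total mass at most 1 is what the test density argument
    asks for.\<close>
  have "two_sided_exp a b y \<le> a / (a + b) * exponential_density (1 / a) y + b / (a + b) * exponential_density (1 / b) (- y)" for y
    using a b
    by (cases "0 \<le> y"; cases "0 \<le> - y")
      (auto simp: two_sided_exp_def exponential_density_def max_def intro!: divide_right_mono)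
  then have "(\<integral>\<^sup>+y. ennreal (two_sided_exp a b y) \<partial>lborel) \<le>
    (\<integral>\<^sup>+y. ennreal (a / (a + b)) * ennreal (exponential_density (1 / a) y) +
      ennreal (b / (a + b)) * ennreal (exponential_density (1 / b) (- y)) \<partial>lborel)"
    using a b
    by (intro nn_integral_mono)
      (auto simp: exponential_density_nonneg simp flip: ennreal_mult ennreal_plus intro!: ennreal_leI)
  also have "\<dots> = ennreal (a / (a + b)) * (\<integral>\<^sup>+y. ennreal (exponential_density (1 / a) y) \<partial>lborel) +
      ennreal (b / (a + b)) * (\<integral>\<^sup>+y. ennreal (exponential_density (1 / b) (- y)) \<partial>lborel)"
    by (subst nn_integral_add) (auto simp: nn_integral_cmult)
  also have "(\<integral>\<^sup>+y. ennreal (exponential_density (1 / b) (- y)) \<partial>lborel) =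
      (\<integral>\<^sup>+y. ennreal (exponential_density (1 / b) y) \<partial>lborel)"
    by (subst (2) nn_integral_real_affine[where c="-1" and t=0]) auto
  also have "ennreal (a / (a + b)) * (\<integral>\<^sup>+y. ennreal (exponential_density (1 / a) y) \<partial>lborel) +
      ennreal (b / (a + b)) * (\<integral>\<^sup>+y. ennreal (exponential_density (1 / b) y) \<partial>lborel) = 1"
    using a b by (simp add: nn_integral_exponential_density flip: ennreal_plus add_divide_distrib)
  finally show ?thesis .
qed

section \<open>Upper bounds for admissible inputs, and passage to the supremum\<close>

lemma awgn_input_admissible: "0 < \<sigma> \<Longrightarrow> P \<in> admissible_inputs En \<Longrightarrow> awgn_input P \<sigma>"
  by (simp add: admissible_inputs_def awgn_input_def awgn_input_axioms_def)

lemma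
  assumes P: "P \<in> admissible_inputs En" and En: "0 < En"
  shows admissible_integrable: "integrable P (\<lambda>x. x)"
    and admissible_mean_le: "(\<integral>x. x \<partial>P) \<le> En"
proof -
  have [measurable_cong]: "sets P = sets borel" and AE: "AE x in P. 0 \<le> x"
    and le: "(\<integral>\<^sup>+ x. ennreal x \<partial>P) \<le> ennreal En"
    using P by (auto simp: admissible_inputs_def)
  show int: "integrable P (\<lambda>x. x)"
    using AE le by (intro integrableI_nonneg) (auto intro: le_less_trans)
  show "(\<integral>x. x \<partial>P) \<le> En"
    using le En nn_integral_eq_integral[OF int AE] by simp
qed

text \<open>The two-sided exponential replaces the exponential density of mean \<open>En\<close>, which
  maximizes entropy on the half-line, because the output can be negative.\<close>

lemma chan_MI_le_high_power:
  assumes "0 < \<sigma>" "0 < En" "0 < a" "P \<in> admissible_inputs En"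
  shows "chan_MI \<sigma> P \<le> max 0 (ln (En + a) + 1 / 2 + \<sigma> / En + \<sigma> / a - ln (2 * pi * \<sigma>\<^sup>2) / 2)"
proof -
  interpret awgn_input P \<sigma> using awgn_input_admissible assms by blast
  note int = integrable_snd[OF integrable_noise_sq[OF sigma_pos]] integrable_snd[OF integrable_noise_abs[OF sigma_pos]]
    integrable_fst[OF admissible_integrable[OF assms(4,2)]]
  define B where "B \<omega> = ln (En + a) - ln (2 * pi * \<sigma>\<^sup>2) / 2 - (snd \<omega>)\<^sup>2 / (2 * \<sigma>\<^sup>2)
    + (fst \<omega> + \<bar>snd \<omega>\<bar>) / En + \<bar>snd \<omega>\<bar> / a" for \<omega> :: "real \<times> real"
  have le: "chan_MI \<sigma> P \<le> max 0 (\<integral>\<omega>. B \<omega> \<partial>(P \<Otimes>\<^sub>M noise \<sigma>))"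
  proof (rule chan_MI_le[where g="two_sided_exp En a"])
    show "integrable (P \<Otimes>\<^sub>M noise \<sigma>) B"
      unfolding B_def[abs_def] using int by simp
    have "AE x in P. 0 \<le> x" using assms by (simp add: admissible_inputs_def)
    from AE_fst[OF this] show "AE \<omega> in P \<Otimes>\<^sub>M noise \<sigma>.
      ln (normal_density 0 \<sigma> (snd \<omega>) / two_sided_exp En a (fst \<omega> + snd \<omega>)) \<le> B \<omega>"
    proof eventually_elim
      case (elim \<omega>)
      have "0 < two_sided_exp En a (fst \<omega> + snd \<omega>)" "0 < normal_density 0 \<sigma> (snd \<omega>)"
        using two_sided_exp_pos normal_density_pos assms by auto
      then show ?case
        using two_sided_exp_lower[OF assms(2,3) elim, of "snd \<omega>"] ln_normal_density[OF sigma_pos, of 0 "snd \<omega>"]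
        by (simp add: ln_div B_def)
    qed
  qed (use assms nn_integral_two_sided_exp two_sided_exp_pos in auto)
  \<comment> \<open>The final \<open>1 / 2\<close> arises as \<open>1 - 1 / 2\<close>: the mean
    input divided by \<open>En\<close> is at most 1, and the quadratic noise term has mean
    \<open>1 / 2\<close>.\<close>
  have "(\<integral>\<omega>. B \<omega> \<partial>(P \<Otimes>\<^sub>M noise \<sigma>)) = ln (En + a) - ln (2 * pi * \<sigma>\<^sup>2) / 2 - \<sigma>\<^sup>2 / (2 * \<sigma>\<^sup>2)
     + ((\<integral>x. x \<partial>P) + (\<integral>z. \<bar>z\<bar> \<partial>noise \<sigma>)) / En + (\<integral>z. \<bar>z\<bar> \<partial>noise \<sigma>) / a"
    unfolding B_def using int PZ.P.prob_space
    by (simp add: integral_snd[OF integrable_noise_sq[OF sigma_pos]] integral_snd[OF integrable_noise_abs[OF sigma_pos]]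
        integral_fst[OF admissible_integrable[OF assms(4,2)]] integral_noise_sq[OF sigma_pos])
  moreover have "((\<integral>x. x \<partial>P) + (\<integral>z. \<bar>z\<bar> \<partial>noise \<sigma>)) / En \<le> (En + \<sigma>) / En"
    "(\<integral>z. \<bar>z\<bar> \<partial>noise \<sigma>) / a \<le> \<sigma> / a"
    using integral_noise_abs_le[OF sigma_pos] admissible_mean_le[OF assms(4,2)] assms(2,3)
    by (auto intro!: divide_right_mono add_mono)
  moreover have "(En + \<sigma>) / En = 1 + \<sigma> / En" "\<sigma>\<^sup>2 / (2 * \<sigma>\<^sup>2) = 1 / 2"
    using assms by (auto simp: field_simps)
  ultimately have "(\<integral>\<omega>. B \<omega> \<partial>(P \<Otimes>\<^sub>M noise \<sigma>)) \<le> ln (En + a) + 1 / 2 + \<sigma> / En + \<sigma> / a - ln (2 * pi * \<sigma>\<^sup>2) / 2"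
    by linarith
  with le show ?thesis by linarith
qed

lemma capacity_le:
  assumes "0 < En" "\<And>P. P \<in> admissible_inputs En \<Longrightarrow> chan_MI \<sigma> P \<le> c"
  shows "capacity \<sigma> En \<le> c"
proof -
  \<comment> \<open>The supremum of reals obeys an upper bound of its members only for a nonempty
    set; the input that is constantly 0 is a witness.\<close>
  have "return borel 0 \<in> admissible_inputs En"
    using assms(1) by (auto simp: admissible_inputs_def AE_return nn_integral_return intro!: prob_space_return)
  then show ?thesis unfolding capacity_def using assms(2) by (intro cSUP_least) auto
qed

text \<open>A real supremum dominates its members once they are bounded above. The high-power bound
  with \<open>a = 1\<close> holds for every positive \<open>En\<close>, so it supplies the bound at
  low power too.\<close>

lemma capacity_ge:
  assumes "0 < \<sigma>" "0 < En" "P \<in> admissible_inputs En"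
  shows "chan_MI \<sigma> P \<le> capacity \<sigma> En"
  unfolding capacity_def
proof (rule cSUP_upper[OF assms(3)])
  show "bdd_above (chan_MI \<sigma> ` admissible_inputs En)"
    using chan_MI_le_high_power[OF assms(1,2) zero_less_one] by (intro bdd_aboveI2)
qed

text \<open>With \<open>\<epsilon> = En / \<sigma>\<close>, the test density is \<open>1 - \<epsilon>\<close> times the noise density plus \<open>\<epsilon>\<close> times a
  Laplace density.  The first part bounds the divergence by about \<open>x\<^sup>2 / (2 * \<sigma>\<^sup>2)\<close>, the second by about
  \<open>ln (1 / \<epsilon>) + x / \<sigma>\<close>; for every \<open>x \<ge> 0\<close> one of them lies below the line of slope
  \<open>2 * sqrt (ln (1 / \<epsilon>)) / \<sigma>\<close>.\<close>

lemma chan_MI_le_low_power: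
  assumes "0 < \<sigma>" "0 < En" "P \<in> admissible_inputs En" and small: "En / \<sigma> \<le> 1 / 2" and L: "16 \<le> ln (\<sigma> / En)"
  shows "chan_MI \<sigma> P \<le> En / \<sigma> * (2 * sqrt (ln (\<sigma> / En)) + 3)"
proof -
  interpret awgn_input P \<sigma> using awgn_input_admissible assms by blast
  define \<epsilon> where "\<epsilon> = En / \<sigma>"
  define s where "s = sqrt (ln (\<sigma> / En))"
  have eps: "0 < \<epsilon>" "\<epsilon> \<le> 1 / 2" using assms by (auto simp: \<epsilon>_def)
  have s: "4 \<le> s" using L real_le_rsqrt[of 4 "ln (\<sigma> / En)"] by (simp add: s_def)
  have lneps: "ln \<epsilon> = - s\<^sup>2" using assms L by (simp add: \<epsilon>_def s_def ln_div)
  have ln1: "- 2 * \<epsilon> \<le> ln (1 - \<epsilon>)"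
  proof -
    have "2 * \<epsilon>\<^sup>2 \<le> \<epsilon>" using eps by (simp add: power2_eq_square)
    then show ?thesis using ln_one_minus_pos_lower_bound[of \<epsilon>] eps by simp
  qed
  define g where "g y = (1 - \<epsilon>) * normal_density 0 \<sigma> y + \<epsilon> * two_sided_exp \<sigma> \<sigma> y" for y
  have g1: "(1 - \<epsilon>) * normal_density 0 \<sigma> y \<le> g y" and g2: "\<epsilon> * two_sided_exp \<sigma> \<sigma> y \<le> g y" for y
    using eps two_sided_exp_pos[OF sigma_pos sigma_pos, of y] by (auto simp: g_def)
  have g_pos: "0 < g y" for y
    using eps two_sided_exp_pos[OF sigma_pos sigma_pos, of y] g2[of y] by (intro less_le_trans[OF _ g2]) simp
  \<comment> \<open>The term \<open>2 * \<epsilon>\<close> pays for the weight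
    \<open>1 - \<epsilon>\<close>. The product term absorbs the noise: the cross term of the square
    for small inputs, the bare \<open>\<bar>z\<bar> / \<sigma>\<close> for large ones. Its mean is
    at most \<open>En / \<sigma>\<close>, so together they give the 3 of the conclusion.\<close>
  define B where "B \<omega> = 2 * \<epsilon> + (fst \<omega> * (2 * s / \<sigma>) + fst \<omega> * \<bar>snd \<omega>\<bar> / \<sigma>\<^sup>2)" for \<omega> :: "real \<times> real"
  note intX = admissible_integrable[OF assms(3,2)] and intZ = integrable_noise_abs[OF sigma_pos]
  note int = integrable_fst[OF intX] PZ.integrable_fst_mult_snd[OF intX intZ]
  have pw: "ln (normal_density 0 \<sigma> z / g (x + z)) \<le> B (x, z)" if x: "0 \<le> x" for x z
  proof -
    have phi: "0 < normal_density 0 \<sigma> y" for y using sigma_pos by (rule normal_density_pos)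
    define t w where "t = x / \<sigma>" and "w = \<bar>z\<bar> / \<sigma>"
    have tw: "0 \<le> t" "0 \<le> w" using x sigma_pos by (auto simp: t_def w_def)
    have B: "B (x, z) = 2 * \<epsilon> + 2 * s * t + t * w"
      using sigma_pos by (simp add: B_def t_def w_def field_simps power2_eq_square)
    have lhs: "ln (normal_density 0 \<sigma> z / g (x + z)) = ln (normal_density 0 \<sigma> z) - ln (g (x + z))"
      using phi[of z] g_pos[of "x + z"] by (simp add: ln_div)
    \<comment> \<open>The parabola \<open>t * t / 2\<close> meets the line \<open>2 * s * t\<close>
      at \<open>t = 4 * s\<close>. From there on \<open>s * s \<le> s * t / 4\<close>, and
      \<open>4 \<le> s\<close> gives \<open>t \<le> s * t / 4\<close>, so \<open>s * s + t\<close>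
      is below the line as well.\<close>
    show ?thesis
    proof (cases "t \<le> 4 * s")
      case True
      have "ln ((1 - \<epsilon>) * normal_density 0 \<sigma> (x + z)) \<le> ln (g (x + z))"
        using g1 eps phi by (intro ln_mono) auto
      then have "ln (normal_density 0 \<sigma> z) - ln (g (x + z)) \<le> 2 * \<epsilon> + ((x + z)\<^sup>2 / (2 * \<sigma>\<^sup>2) - z\<^sup>2 / (2 * \<sigma>\<^sup>2))"
        using ln1 eps phi[of "x + z"] by (simp add: ln_mult ln_normal_density[OF sigma_pos])
      also have "(x + z)\<^sup>2 / (2 * \<sigma>\<^sup>2) - z\<^sup>2 / (2 * \<sigma>\<^sup>2) = t * t / 2 + x * z / \<sigma>\<^sup>2"
        using sigma_pos by (simp add: t_def field_simps power2_eq_square)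
      also have "x * z / \<sigma>\<^sup>2 \<le> x * \<bar>z\<bar> / \<sigma>\<^sup>2"
        using x by (intro divide_right_mono mult_left_mono) auto
      also have "x * \<bar>z\<bar> / \<sigma>\<^sup>2 = t * w" by (simp add: t_def w_def power2_eq_square)
      also have "t * t / 2 \<le> 2 * s * t"
        using mult_right_mono[OF True, of t] tw by simp
      finally show ?thesis unfolding lhs B by simp
    next
      case False
      then have t: "4 * s \<le> t" by simp
      have "ln (\<epsilon> * two_sided_exp \<sigma> \<sigma> (x + z)) \<le> ln (g (x + z))"
        using g2 eps two_sided_exp_pos[OF sigma_pos sigma_pos] by (intro ln_mono) auto
      then have "- ln (g (x + z)) \<le> s\<^sup>2 - ln (two_sided_exp \<sigma> \<sigma> (x + z))"
        using lneps eps two_sided_exp_pos[OF sigma_pos sigma_pos, of "x + z"] by (simp add: ln_mult)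
      moreover have "\<bar>x + z\<bar> = max (x + z) 0 + max (- (x + z)) 0" by simp
      then have "- ln (two_sided_exp \<sigma> \<sigma> (x + z)) = ln (2 * \<sigma>) + \<bar>x + z\<bar> / \<sigma>"
        using sigma_pos by (simp only: ln_two_sided_exp[OF sigma_pos sigma_pos]) (simp add: add_divide_distrib)
      moreover have "\<bar>x + z\<bar> / \<sigma> \<le> t + w"
        using x sigma_pos by (auto simp: t_def w_def simp flip: add_divide_distrib intro!: divide_right_mono)
      \<comment> \<open>Since \<open>4 \<le> 2 * pi\<close>, the peak of the noise density does not
        exceed that of the Laplace density, and the term \<open>ln (2 * \<sigma>)\<close>
        cancels.\<close>
      moreover have "ln (normal_density 0 \<sigma> z) \<le> - ln (2 * \<sigma>)"
      proof -
        have "ln ((2 * \<sigma>)\<^sup>2) \<le> ln (2 * pi * \<sigma>\<^sup>2)"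
          using sigma_pos pi_ge_two by (intro ln_mono) (auto simp: power2_eq_square)
        moreover have "ln ((2 * \<sigma>)\<^sup>2) = 2 * ln (2 * \<sigma>)" using sigma_pos ln_realpow[of "2 * \<sigma>" 2] by simp
        moreover have "0 \<le> (z - 0)\<^sup>2 / (2 * \<sigma>\<^sup>2)" by simp
        ultimately show ?thesis unfolding ln_normal_density[OF sigma_pos] by linarith
      qed
      ultimately have "ln (normal_density 0 \<sigma> z) - ln (g (x + z)) \<le> s * s + t + w"
        by (simp add: power2_eq_square)
      moreover have "s * s \<le> s * t / 4" using mult_left_mono[OF t, of s] s by simp
      moreover have "4 * t \<le> s * t" using mult_right_mono[OF s, of t] tw by simp
      moreover have "1 * w \<le> t * w" using t s tw by (intro mult_right_mono) auto
      ultimately show ?thesis unfolding lhs B using eps tw by simp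
    qed
  qed
  have "chan_MI \<sigma> P \<le> max 0 (\<integral>\<omega>. B \<omega> \<partial>(P \<Otimes>\<^sub>M noise \<sigma>))"
  proof (rule chan_MI_le[where g=g])
    show "g \<in> borel_measurable borel" unfolding g_def[abs_def] by measurable
    show "(\<integral>\<^sup>+y. ennreal (g y) \<partial>lborel) \<le> 1"
    proof -
      have "(\<integral>\<^sup>+y. ennreal (g y) \<partial>lborel) = (\<integral>\<^sup>+y. ennreal (1 - \<epsilon>) * ennreal (normal_density 0 \<sigma> y) +
          ennreal \<epsilon> * ennreal (two_sided_exp \<sigma> \<sigma> y) \<partial>lborel)"
        using eps two_sided_exp_pos[OF sigma_pos sigma_pos, THEN less_imp_le]
        by (intro nn_integral_cong) (simp add: g_def ennreal_mult' ennreal_plus)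
      also have "\<dots> = ennreal (1 - \<epsilon>) * (\<integral>\<^sup>+y. ennreal (normal_density 0 \<sigma> y) \<partial>lborel) +
          ennreal \<epsilon> * (\<integral>\<^sup>+y. ennreal (two_sided_exp \<sigma> \<sigma> y) \<partial>lborel)"
        by (subst nn_integral_add) (auto simp: nn_integral_cmult)
      also have "\<dots> \<le> ennreal (1 - \<epsilon>) * 1 + ennreal \<epsilon> * 1"
        using sigma_pos nn_integral_two_sided_exp[OF sigma_pos sigma_pos]
        by (intro add_mono mult_left_mono) (auto simp: nn_integral_eq_integral)
      also have "\<dots> = 1" using eps by (simp flip: ennreal_plus)
      finally show ?thesis .
    qed
    show "integrable (P \<Otimes>\<^sub>M noise \<sigma>) B"
      unfolding B_def[abs_def] using int by simp
    have "AE x in P. 0 \<le> x" using assms by (simp add: admissible_inputs_def)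
    from AE_fst[OF this] show "AE \<omega> in P \<Otimes>\<^sub>M noise \<sigma>. ln (normal_density 0 \<sigma> (snd \<omega>) / g (fst \<omega> + snd \<omega>)) \<le> B \<omega>"
      by eventually_elim (use pw in force)
  qed (rule g_pos)
  also have "(\<integral>\<omega>. B \<omega> \<partial>(P \<Otimes>\<^sub>M noise \<sigma>)) = 2 * \<epsilon> + ((\<integral>x. x \<partial>P) * (2 * s / \<sigma>) +
      (\<integral>x. x \<partial>P) * (\<integral>z. \<bar>z\<bar> \<partial>noise \<sigma>) / \<sigma>\<^sup>2)"
    unfolding B_def using int PZ.P.prob_space
    by (simp add: integral_fst[OF intX] PZ.integral_fst_mult_snd[OF intX intZ])
  also have "max 0 \<dots> \<le> 2 * \<epsilon> + (En * (2 * s / \<sigma>) + En * \<sigma> / \<sigma>\<^sup>2)"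
  proof -
    have "(\<integral>x. x \<partial>P) * (2 * s / \<sigma>) \<le> En * (2 * s / \<sigma>)"
      using admissible_mean_le[OF assms(3,2)] s sigma_pos by (intro mult_right_mono) auto
    moreover have "(\<integral>x. x \<partial>P) * (\<integral>z. \<bar>z\<bar> \<partial>noise \<sigma>) / \<sigma>\<^sup>2 \<le> En * \<sigma> / \<sigma>\<^sup>2"
      using admissible_mean_le[OF assms(3,2)] integral_noise_abs_le[OF sigma_pos] assms(2)
      by (intro divide_right_mono mult_mono) auto
    moreover have "0 \<le> 2 * \<epsilon>" "0 \<le> En * (2 * s / \<sigma>)" "0 \<le> En * \<sigma> / \<sigma>\<^sup>2"
      using eps s assms by auto
    ultimately show ?thesis by linarith
  qed
  also have "\<dots> = En / \<sigma> * (2 * s + 3)"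
    using sigma_pos by (simp add: \<epsilon>_def field_simps power2_eq_square)
  finally show ?thesis by (simp add: s_def)
qed


section \<open>Lower bounds from explicit inputs\<close>

text \<open>The bound on the output density is log-linear in \<open>y\<close>, so its expectation
  needs only the means of \<open>X\<close> and \<open>Z\<close>. The loss
  \<open>\<sigma>\<^sup>2 / (2 * En\<^sup>2)\<close> is the log moment generating function of the
  noise at \<open>1 / En\<close>.\<close>

lemma chan_MI_exponential_ge:
  assumes "0 < \<sigma>" "0 < En"
  defines "P \<equiv> density lborel (exponential_density (1 / En))"
  shows "P \<in> admissible_inputs En"
    and "ln En + 1 / 2 - \<sigma>\<^sup>2 / (2 * En\<^sup>2) - ln (2 * pi * \<sigma>\<^sup>2) / 2 \<le> chan_MI \<sigma> P"
proof -
  have "prob_space P" unfolding P_def using assms by (intro prob_space_exponential_density) simp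
  then interpret awgn_input P \<sigma>
    using assms by (simp add: awgn_input_def awgn_input_axioms_def P_def)
  have l: "0 < 1 / En" using assms by simp
  have D: "distributed P lborel (\<lambda>x. x) (exponential_density (1 / En))"
    unfolding distributed_def using distr_id2[of lborel P] by (simp add: P_def)
  have moments: "integrable P (\<lambda>x. x ^ i)" "(\<integral>x. x ^ i \<partial>P) = fact i * En ^ i" for i
    using erlang_ith_moment_integrable[OF l D] erlang_ith_moment[OF l D] assms
    by (simp_all add: power_one_over)
  note intX = moments(1)[of 1, simplified]
  have AE: "AE x in P. 0 \<le> x"
    unfolding P_def by (subst AE_density) (auto simp: exponential_density_def)
  show "P \<in> admissible_inputs En"
    using prob_space_axioms AE sets_P nn_integral_eq_integral[OF intX AE] moments(2)[of 1]
    by (simp add: admissible_inputs_def)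
  have f: "out_density y \<le> exp (\<sigma>\<^sup>2 / (2 * En\<^sup>2) - y / En) / En" for y
  proof -
    have "out_density y = (\<integral>x. exponential_density (1 / En) x * normal_density x \<sigma> y \<partial>lborel)"
      unfolding out_density_def
      using exponential_density_nonneg[OF l] measurable_transition_fst[of y]
      by (subst P_def, subst integral_real_density) (simp_all add: P_def)
    also have "\<dots> \<le> (\<integral>x. exp (\<sigma>\<^sup>2 / (2 * En\<^sup>2) - y / En) / En * normal_density (y - \<sigma>\<^sup>2 / En) \<sigma> x \<partial>lborel)"
    proof (rule Bochner_Integration.integral_mono')
      show "integrable lborel (\<lambda>x. exp (\<sigma>\<^sup>2 / (2 * En\<^sup>2) - y / En) / En * normal_density (y - \<sigma>\<^sup>2 / En) \<sigma> x)"
        using sigma_pos by simp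
      fix x
      show "0 \<le> exp (\<sigma>\<^sup>2 / (2 * En\<^sup>2) - y / En) / En * normal_density (y - \<sigma>\<^sup>2 / En) \<sigma> x"
        using assms by simp
      \<comment> \<open>Completing the square in \<open>x\<close>. With the exponential extended to
        negative \<open>x\<close>, what remains is a full Gaussian of mean
        \<open>y - \<sigma>\<^sup>2 / En\<close>, which integrates to 1.\<close>
      have *: "- x / En - (y - x)\<^sup>2 / (2 * \<sigma>\<^sup>2) =
          \<sigma>\<^sup>2 / (2 * En\<^sup>2) - y / En - (x - (y - \<sigma>\<^sup>2 / En))\<^sup>2 / (2 * \<sigma>\<^sup>2)"
        using assms by (simp add: field_simps power2_eq_square)
      have "exponential_density (1 / En) x * normal_density x \<sigma> y \<le> exp (- x / En) / En * normal_density x \<sigma> y"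
        using assms by (intro mult_right_mono) (auto simp: exponential_density_def)
      also have "\<dots> = exp (- x / En - (y - x)\<^sup>2 / (2 * \<sigma>\<^sup>2)) / (En * sqrt (2 * pi * \<sigma>\<^sup>2))"
        by (simp add: normal_density_def exp_diff exp_minus field_simps)
      also have "\<dots> = exp (\<sigma>\<^sup>2 / (2 * En\<^sup>2) - y / En) / En * normal_density (y - \<sigma>\<^sup>2 / En) \<sigma> x"
      proof -
        have "exp (u - v) / (En * c) = exp u / En * (1 / c * exp (- v))" for u v c
          by (simp add: exp_diff exp_minus field_simps)
        then show ?thesis unfolding * by (simp add: normal_density_def)
      qed
      finally show "exponential_density (1 / En) x * normal_density x \<sigma> y \<le>
          exp (\<sigma>\<^sup>2 / (2 * En\<^sup>2) - y / En) / En * normal_density (y - \<sigma>\<^sup>2 / En) \<sigma> x" .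
    qed
    also have "\<dots> = exp (\<sigma>\<^sup>2 / (2 * En\<^sup>2) - y / En) / En" using sigma_pos by simp
    finally show ?thesis .
  qed
  define B where "B \<omega> = ln En - \<sigma>\<^sup>2 / (2 * En\<^sup>2) - ln (2 * pi * \<sigma>\<^sup>2) / 2 + fst \<omega> / En + snd \<omega> / En
      - (snd \<omega>)\<^sup>2 / (2 * \<sigma>\<^sup>2)" for \<omega> :: "real \<times> real"
  note int = integrable_snd[OF integrable_noise_sq[OF sigma_pos]] integrable_snd[OF integrable_noise[OF sigma_pos]]
    integrable_fst[OF intX]
  have "(\<integral>\<omega>. B \<omega> \<partial>(P \<Otimes>\<^sub>M noise \<sigma>)) \<le> chan_MI \<sigma> P"
  proof (rule chan_MI_ge[OF moments(1)])
    show "integrable (P \<Otimes>\<^sub>M noise \<sigma>) B"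
      unfolding B_def[abs_def] using int by simp
    show "AE \<omega> in P \<Otimes>\<^sub>M noise \<sigma>. B \<omega> \<le> ln (normal_density 0 \<sigma> (snd \<omega>) / out_density (fst \<omega> + snd \<omega>))"
    proof (rule AE_I2)
      fix \<omega> :: "real \<times> real"
      let ?y = "fst \<omega> + snd \<omega>"
      have "ln (out_density ?y) \<le> ln (exp (\<sigma>\<^sup>2 / (2 * En\<^sup>2) - ?y / En) / En)"
        using f out_density_pos by (intro ln_mono) auto
      also have "\<dots> = \<sigma>\<^sup>2 / (2 * En\<^sup>2) - ?y / En - ln En"
        using assms by (simp add: ln_div)
      finally show "B \<omega> \<le> ln (normal_density 0 \<sigma> (snd \<omega>) / out_density ?y)"
        using out_density_pos[of ?y] normal_density_pos[OF sigma_pos, of 0 "snd \<omega>"]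
        by (simp add: ln_div ln_normal_density[OF sigma_pos] B_def add_divide_distrib)
    qed
  qed
  also have "(\<integral>\<omega>. B \<omega> \<partial>(P \<Otimes>\<^sub>M noise \<sigma>)) =
      ln En - \<sigma>\<^sup>2 / (2 * En\<^sup>2) - ln (2 * pi * \<sigma>\<^sup>2) / 2 + En / En + 0 / En - \<sigma>\<^sup>2 / (2 * \<sigma>\<^sup>2)"
    unfolding B_def using int PZ.P.prob_space moments(2)[of 1]
    by (simp add: integral_snd[OF integrable_noise_sq[OF sigma_pos]] integral_snd[OF integrable_noise[OF sigma_pos]]
        integral_fst[OF intX] integral_noise_sq[OF sigma_pos] integral_noise[OF sigma_pos])
  also have "\<dots> = ln En + 1 / 2 - \<sigma>\<^sup>2 / (2 * En\<^sup>2) - ln (2 * pi * \<sigma>\<^sup>2) / 2"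
    using assms by simp
  finally show "ln En + 1 / 2 - \<sigma>\<^sup>2 / (2 * En\<^sup>2) - ln (2 * pi * \<sigma>\<^sup>2) / 2 \<le> chan_MI \<sigma> P" .
qed

text \<open>The mass at 0 contributes nonnegatively because \<open>ln r \<le> r - 1\<close>; the mass at \<open>A\<close> contributes almost
  the full divergence \<open>A\<^sup>2 / (2 * \<sigma>\<^sup>2)\<close>, as \<open>p\<close> is too small to move the output density near \<open>A\<close>.\<close>

lemma chan_MI_two_point_ge:
  assumes "0 < \<sigma>" "0 < A" "0 < p" "p \<le> exp (- A\<^sup>2 / (2 * \<sigma>\<^sup>2))"
  defines "P \<equiv> distr (bernoulli_pmf p) borel (\<lambda>b. if b then A else 0)"
  shows "P \<in> admissible_inputs (p * A)"
    and "p * (A\<^sup>2 / (2 * \<sigma>\<^sup>2) - ln 2 - A / \<sigma>) \<le> chan_MI \<sigma> P"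
proof -
  have "exp (- A\<^sup>2 / (2 * \<sigma>\<^sup>2)) \<le> 1" by simp
  with assms have p: "0 \<le> p" "p \<le> 1" by linarith+
  have "prob_space P" unfolding P_def by (intro measure_pmf.prob_space_distr) simp
  then interpret awgn_input P \<sigma>
    using assms by (simp add: awgn_input_def awgn_input_axioms_def P_def)
  have AE: "AE x in P. x \<in> {0, A}"
    unfolding P_def by (subst AE_distr_iff) auto
  have int: "integrable P u" if "u \<in> borel_measurable borel" for u :: "real \<Rightarrow> real"
    unfolding P_def using that by (subst integrable_distr_eq) (auto intro: integrable_measure_pmf_finite)
  have integ: "(\<integral>x. u x \<partial>P) = p * u A + (1 - p) * u 0" if "u \<in> borel_measurable borel" for u :: "real \<Rightarrow> real"
    unfolding P_def using that p by (subst integral_distr) auto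
  show "P \<in> admissible_inputs (p * A)"
  proof -
    have "AE x in P. 0 \<le> x" using AE by eventually_elim (use assms in auto)
    from this nn_integral_eq_integral[OF int this] show ?thesis
      using prob_space_axioms sets_P by (simp add: admissible_inputs_def integ)
  qed
  have f: "out_density y = p * normal_density A \<sigma> y + (1 - p) * normal_density 0 \<sigma> y" for y
    unfolding out_density_def by (rule integ) (simp add: normal_density_def)
  define k where "k = A\<^sup>2 / (2 * \<sigma>\<^sup>2) - ln 2"
  \<comment> \<open>The likelihood ratio of output to noise has mean 1 under the noise, so
    \<open>1 - r\<close> has mean 0. It bounds the information density at input 0 from
    below.\<close>
  define r where "r z = out_density z / normal_density 0 \<sigma> z" for z
  have phi: "0 < normal_density 0 \<sigma> z" for z using assms(1) by (rule normal_density_pos)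
  have r: "integrable (noise \<sigma>) r" "(\<integral>z. r z \<partial>noise \<sigma>) = 1"
  proof -
    have *: "normal_density 0 \<sigma> z * r z = p * normal_density A \<sigma> z + (1 - p) * normal_density 0 \<sigma> z" for z
      using phi[of z] by (simp add: r_def f)
    have [measurable]: "r \<in> borel_measurable borel" unfolding r_def[abs_def] by measurable
    show "integrable (noise \<sigma>) r" "(\<integral>z. r z \<partial>noise \<sigma>) = 1"
      using sigma_pos by (simp_all add: integrable_real_density integral_real_density *)
  qed
  \<comment> \<open>On the support \<open>{0, A}\<close> the factors \<open>x / A\<close> and
    \<open>1 - x / A\<close> are the indicators of the two input values. Written this way,
    \<open>B\<close> is a sum of products and its integral factors.\<close>
  define B where "B \<omega> = fst \<omega> / A * (k - A * \<bar>snd \<omega>\<bar> / \<sigma>\<^sup>2) + (1 - fst \<omega> / A) * (1 - r (snd \<omega>))" for \<omega> :: "real \<times> real"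
  have v1: "integrable (noise \<sigma>) (\<lambda>z. k - A * \<bar>z\<bar> / \<sigma>\<^sup>2)" and v2: "integrable (noise \<sigma>) (\<lambda>z. 1 - r z)"
    using integrable_noise_abs[OF sigma_pos] r by simp_all
  have u1: "integrable P (\<lambda>x. x / A)" and u2: "integrable P (\<lambda>x. 1 - x / A)" by (intro int; simp)+
  note prod = PZ.integrable_fst_mult_snd[OF u1 v1] PZ.integrable_fst_mult_snd[OF u2 v2]
  have "(\<integral>\<omega>. B \<omega> \<partial>(P \<Otimes>\<^sub>M noise \<sigma>)) \<le> chan_MI \<sigma> P"
  proof (rule chan_MI_ge[OF int])
    show "integrable (P \<Otimes>\<^sub>M noise \<sigma>) B"
      unfolding B_def[abs_def] using prod by (rule Bochner_Integration.integrable_add)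
    show "AE \<omega> in P \<Otimes>\<^sub>M noise \<sigma>. B \<omega> \<le> ln (normal_density 0 \<sigma> (snd \<omega>) / out_density (fst \<omega> + snd \<omega>))"
      using AE_fst[OF AE]
    proof eventually_elim
      case (elim \<omega>)
      obtain x z where w: "\<omega> = (x, z)" by fastforce
      note fp = out_density_pos[of "x + z"]
      have lhs: "ln (normal_density 0 \<sigma> z / out_density (x + z)) = - ln (out_density (x + z) / normal_density 0 \<sigma> z)"
        using phi[of z] fp by (simp add: ln_div)
      consider "x = 0" | "x = A" using elim w by auto
      then show ?case
      proof cases
        case 1
        have "ln (r z) \<le> r z - 1"
          using phi[of z] out_density_pos[of z] by (intro ln_le_minus_one) (simp add: r_def)
        then show ?thesis using lhs 1 by (simp add: w B_def r_def)
      next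
        case 2
        define q m where "q = A\<^sup>2 / (2 * \<sigma>\<^sup>2)" and "m = A * \<bar>z\<bar> / \<sigma>\<^sup>2"
        have m: "0 \<le> m" using assms by (simp add: m_def)
        have "normal_density 0 \<sigma> (A + z) / normal_density 0 \<sigma> z = exp (z\<^sup>2 / (2 * \<sigma>\<^sup>2) - (A + z)\<^sup>2 / (2 * \<sigma>\<^sup>2))"
        proof -
          have "normal_density 0 \<sigma> (A + z) =
              normal_density 0 \<sigma> z * exp (z\<^sup>2 / (2 * \<sigma>\<^sup>2) - (A + z)\<^sup>2 / (2 * \<sigma>\<^sup>2))"
            by (simp add: normal_density_def mult.assoc flip: exp_add)
          then show ?thesis using phi[of z] by simp
        qed
        also have "z\<^sup>2 / (2 * \<sigma>\<^sup>2) - (A + z)\<^sup>2 / (2 * \<sigma>\<^sup>2) = - q - A * z / \<sigma>\<^sup>2"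
          using sigma_pos by (simp add: q_def field_simps power2_eq_square)
        also have "exp (- q - A * z / \<sigma>\<^sup>2) \<le> exp (m - q)"
        proof -
          have "A * - z / \<sigma>\<^sup>2 \<le> m"
            unfolding m_def using assms by (intro divide_right_mono mult_left_mono) auto
          then show ?thesis by simp
        qed
        finally have ratio: "normal_density 0 \<sigma> (A + z) / normal_density 0 \<sigma> z \<le> exp (m - q)" .
        have "out_density (A + z) / normal_density 0 \<sigma> z = p + (1 - p) * (normal_density 0 \<sigma> (A + z) / normal_density 0 \<sigma> z)"
          using phi[of z] by (simp add: f normal_density_shift field_simps)
        \<comment> \<open>By the assumption on \<open>p\<close>, neither component of the mixture
          exceeds \<open>exp (m - q)\<close>; adding the two equal bounds is the origin of the loss
          \<open>ln 2\<close>.\<close>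
        also have "\<dots> \<le> exp (m - q) + 1 * exp (m - q)"
        proof (intro add_mono mult_mono ratio)
          have "p \<le> exp (- q)" using assms by (simp add: q_def)
          also have "\<dots> \<le> exp (m - q)" using m by simp
          finally show "p \<le> exp (m - q)" .
        qed (use p phi[THEN less_imp_le] in auto)
        finally have "out_density (A + z) / normal_density 0 \<sigma> z \<le> 2 * exp (m - q)" by simp
        then have "ln (out_density (A + z) / normal_density 0 \<sigma> z) \<le> ln (2 * exp (m - q))"
          using fp phi[of z] 2 by (intro ln_mono) auto
        also have "\<dots> = ln 2 + m - q" by (simp add: ln_mult)
        finally show ?thesis using lhs 2 assms(2) by (simp add: w B_def k_def q_def m_def)
      qed
    qed
  qed simp
  moreover have "(\<integral>\<omega>. B \<omega> \<partial>(P \<Otimes>\<^sub>M noise \<sigma>)) = p * (k - A * (\<integral>z. \<bar>z\<bar> \<partial>noise \<sigma>) / \<sigma>\<^sup>2)"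
  proof -
    have "(\<integral>\<omega>. B \<omega> \<partial>(P \<Otimes>\<^sub>M noise \<sigma>)) = (\<integral>x. x / A \<partial>P) * (\<integral>z. k - A * \<bar>z\<bar> / \<sigma>\<^sup>2 \<partial>noise \<sigma>) +
        (\<integral>x. 1 - x / A \<partial>P) * (\<integral>z. 1 - r z \<partial>noise \<sigma>)"
      unfolding B_def
      by (simp only: Bochner_Integration.integral_add[OF prod] PZ.integral_fst_mult_snd[OF u1 v1] PZ.integral_fst_mult_snd[OF u2 v2])
    also have "(\<integral>z. 1 - r z \<partial>noise \<sigma>) = 0" using r Z.prob_space by simp
    also have "(\<integral>x. x / A \<partial>P) = p" using assms(2) by (subst integ) auto
    also have "(\<integral>z. k - A * \<bar>z\<bar> / \<sigma>\<^sup>2 \<partial>noise \<sigma>) = k - A * (\<integral>z. \<bar>z\<bar> \<partial>noise \<sigma>) / \<sigma>\<^sup>2"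
      using integrable_noise_abs[OF sigma_pos] Z.prob_space by simp
    finally show ?thesis by simp
  qed
  moreover have "p * (k - A / \<sigma>) \<le> p * (k - A * (\<integral>z. \<bar>z\<bar> \<partial>noise \<sigma>) / \<sigma>\<^sup>2)"
  proof -
    have "A * (\<integral>z. \<bar>z\<bar> \<partial>noise \<sigma>) / \<sigma>\<^sup>2 \<le> A * \<sigma> / \<sigma>\<^sup>2"
      using integral_noise_abs_le[OF sigma_pos] assms by (intro divide_right_mono mult_left_mono) auto
    also have "\<dots> = A / \<sigma>" by (simp add: power2_eq_square)
    finally show ?thesis using p by (intro mult_left_mono) auto
  qed
  ultimately show "p * (A\<^sup>2 / (2 * \<sigma>\<^sup>2) - ln 2 - A / \<sigma>) \<le> chan_MI \<sigma> P"
    by (simp add: k_def)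
qed


section \<open>Passing to the limits of large and small power\<close>

lemma capacity_high_power:
  assumes [arith]: "0 < \<sigma>"
  shows "((\<lambda>En. capacity \<sigma> En - ln (En / \<sigma>)) \<longlongrightarrow> 1 / 2 * ln (exp 1 / (2 * pi))) at_top"
proof -
  have lim: "1 / 2 + ln \<sigma> - ln (2 * pi * \<sigma>\<^sup>2) / 2 = 1 / 2 * ln (exp 1 / (2 * pi))"
    using ln_realpow[of \<sigma> 2] by (simp add: ln_div ln_mult field_simps)
  \<comment> \<open>The left tail scale \<open>a = sqrt En\<close> is small against
    \<open>En\<close> and large against \<open>\<sigma>\<close>, so both
    \<open>ln (En + a) - ln En\<close> and \<open>\<sigma> / a\<close> vanish. As \<open>U\<close>
    tends to infinity, it eventually absorbs the maximum with 0.\<close>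
  define U where "U En = ln (En + sqrt En) + 1 / 2 + \<sigma> / En + \<sigma> / sqrt En - ln (2 * pi * \<sigma>\<^sup>2) / 2" for En
  have U: "filterlim U at_top at_top" unfolding U_def by real_asymp
  show ?thesis unfolding lim[symmetric]
  proof (rule tendsto_sandwich)
    show "((\<lambda>En. 1 / 2 + ln \<sigma> - ln (2 * pi * \<sigma>\<^sup>2) / 2 - \<sigma>\<^sup>2 / (2 * En\<^sup>2))
        \<longlongrightarrow> 1 / 2 + ln \<sigma> - ln (2 * pi * \<sigma>\<^sup>2) / 2) at_top"
      by real_asymp
    show "((\<lambda>En. U En - ln (En / \<sigma>)) \<longlongrightarrow> 1 / 2 + ln \<sigma> - ln (2 * pi * \<sigma>\<^sup>2) / 2) at_top"
    proof -
      have "1 / 2 + ln \<sigma> - ln (2 * pi * \<sigma>\<^sup>2) / 2 = 1 / 2 - ln (2 * pi * \<sigma>\<^sup>2) / 2 - ln (inverse \<sigma>)"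
        by (simp add: ln_inverse)
      then show ?thesis unfolding U_def by simp real_asymp
    qed
    show "\<forall>\<^sub>F En in at_top. 1 / 2 + ln \<sigma> - ln (2 * pi * \<sigma>\<^sup>2) / 2 - \<sigma>\<^sup>2 / (2 * En\<^sup>2)
        \<le> capacity \<sigma> En - ln (En / \<sigma>)"
      using eventually_gt_at_top[of 0]
    proof eventually_elim
      case (elim En)
      note exponential = chan_MI_exponential_ge[OF assms elim]
      have "ln (En / \<sigma>) = ln En - ln \<sigma>" using elim by (simp add: ln_div)
      then show ?case using capacity_ge[OF assms elim exponential(1)] exponential(2) by linarith
    qed
    have "\<forall>\<^sub>F En in at_top. 0 \<le> U En" using U by (simp add: filterlim_at_top)
    then show "\<forall>\<^sub>F En in at_top. capacity \<sigma> En - ln (En / \<sigma>) \<le> U En - ln (En / \<sigma>)"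
      using eventually_gt_at_top[of 0]
    proof eventually_elim
      case (elim En)
      have "chan_MI \<sigma> P \<le> U En" if "P \<in> admissible_inputs En" for P
        using chan_MI_le_high_power[OF assms elim(2) _ that, of "sqrt En"] elim by (simp add: U_def)
      then show ?case using capacity_le[of En \<sigma> "U En"] elim by simp
    qed
  qed
qed

text \<open>The point \<open>A\<close> solves
  \<open>exp (- A\<^sup>2 / (2 * \<sigma>\<^sup>2)) = En / \<sigma>\<close>. Mean \<open>En\<close>
  forces the mass \<open>En / A\<close>, and the assumption on the logarithm gives
  \<open>\<sigma> \<le> A\<close>, which keeps this mass below the threshold of the two-point
  bound.\<close>

lemma capacity_low_power_ge:
  assumes "0 < \<sigma>" "0 < En" and L: "1 \<le> ln (\<sigma> / En)"
  shows "En / \<sigma> * (ln (\<sigma> / En) - ln 2 - sqrt (2 * ln (\<sigma> / En))) / sqrt (2 * ln (\<sigma> / En)) \<le> capacity \<sigma> En"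
proof -
  define L where "L = ln (\<sigma> / En)"
  define A where "A = \<sigma> * sqrt (2 * L)"
  have "1 \<le> L" using L by (simp add: L_def)
  have A: "0 < A" "A / \<sigma> = sqrt (2 * L)" "A\<^sup>2 / (2 * \<sigma>\<^sup>2) = L"
    using assms(1) \<open>1 \<le> L\<close> by (simp_all add: A_def power_mult_distrib)
  have "exp (- A\<^sup>2 / (2 * \<sigma>\<^sup>2)) = En / \<sigma>"
    using A(3) assms by (simp add: L_def exp_minus)
  moreover have "En / A \<le> En / \<sigma>"
  proof (rule divide_left_mono)
    show "\<sigma> \<le> A" using assms(1) \<open>1 \<le> L\<close> by (simp add: A_def)
  qed (use A assms in auto)
  ultimately have p: "0 < En / A" "En / A \<le> exp (- A\<^sup>2 / (2 * \<sigma>\<^sup>2))"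
    using assms A by auto
  note two_point = chan_MI_two_point_ge[OF assms(1) A(1) p]
  have "En / A * (L - ln 2 - sqrt (2 * L)) \<le> capacity \<sigma> En"
    using capacity_ge[OF assms(1,2), of "distr (bernoulli_pmf (En / A)) borel (\<lambda>b. if b then A else 0)"]
      two_point A by simp
  then show ?thesis by (simp add: A_def L_def)
qed

lemma capacity_low_power_le:
  assumes "0 < \<sigma>" "0 < En" "En / \<sigma> \<le> 1 / 2" "16 \<le> ln (\<sigma> / En)"
  shows "capacity \<sigma> En \<le> En / \<sigma> * (2 * sqrt (ln (\<sigma> / En)) + 3)"
  using assms by (intro capacity_le chan_MI_le_low_power)

theorem theorem6:
  fixes \<sigma> :: real
  assumes "\<sigma> > 0"
  shows "((\<lambda>En. capacity \<sigma> En - ln (En / \<sigma>)) \<longlongrightarrow> 1/2 * ln (exp 1 / (2 * pi))) at_top \<and>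
    Limsup (at_right 0)
           (\<lambda>En. ereal (capacity \<sigma> En / (En / \<sigma> * sqrt (ln (\<sigma> / En))))) \<le> 2 \<and>
    Liminf (at_right 0)
           (\<lambda>En. ereal (capacity \<sigma> En / (En / \<sigma> * sqrt (ln (\<sigma> / En))))) \<ge> 1 / sqrt 2"
proof (intro conjI)
  show "((\<lambda>En. capacity \<sigma> En - ln (En / \<sigma>)) \<longlongrightarrow> 1/2 * ln (exp 1 / (2 * pi))) at_top"
    using assms by (rule capacity_high_power)
  let ?R = "\<lambda>En. capacity \<sigma> En / (En / \<sigma> * sqrt (ln (\<sigma> / En)))"
  \<comment> \<open>After division by the normalization, both bounds depend on \<open>En\<close>
    only through \<open>ln (\<sigma> / En)\<close>, so the limits reduce to ones of real functions
    at infinity.\<close>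
  have L: "filterlim (\<lambda>En. ln (\<sigma> / En)) at_top (at_right 0)"
    using assms by real_asymp
  have ev: "\<forall>\<^sub>F En in at_right 0. 0 < En \<and> En / \<sigma> \<le> 1 / 2 \<and> 16 \<le> ln (\<sigma> / En)"
  proof (intro eventually_conj)
    show "\<forall>\<^sub>F En in at_right 0. (0::real) < En" by (simp add: eventually_at_right_less)
    show "\<forall>\<^sub>F En in at_right 0. En / \<sigma> \<le> 1 / 2" using assms by real_asymp
    show "\<forall>\<^sub>F En in at_right 0. 16 \<le> ln (\<sigma> / En)" using L by (simp add: filterlim_at_top)
  qed
  show "Limsup (at_right 0) (\<lambda>En. ereal (?R En)) \<le> 2"
  proof -
    have "((\<lambda>t::real. 2 + 3 / sqrt t) \<longlongrightarrow> 2) at_top" by real_asymp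
    from filterlim_compose[OF this L]
    have "((\<lambda>En. ereal (2 + 3 / sqrt (ln (\<sigma> / En)))) \<longlongrightarrow> ereal 2) (at_right 0)" by simp
    then have lim: "Limsup (at_right 0) (\<lambda>En. ereal (2 + 3 / sqrt (ln (\<sigma> / En)))) = ereal 2"
      by (intro lim_imp_Limsup) simp_all
    have "Limsup (at_right 0) (\<lambda>En. ereal (?R En)) \<le> Limsup (at_right 0) (\<lambda>En. ereal (2 + 3 / sqrt (ln (\<sigma> / En))))"
    proof (rule Limsup_mono)
      show "\<forall>\<^sub>F En in at_right 0. ereal (?R En) \<le> ereal (2 + 3 / sqrt (ln (\<sigma> / En)))"
        using ev
      proof eventually_elim
        case (elim En)
        then have pos: "0 < En / \<sigma> * sqrt (ln (\<sigma> / En))" using assms by auto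
        have "e * (2 * t + 3) = (2 + 3 / t) * (e * t)" if "t \<noteq> 0" for e t :: real
          using that by (simp add: field_simps)
        from this[of "sqrt (ln (\<sigma> / En))" "En / \<sigma>"]
        have "En / \<sigma> * (2 * sqrt (ln (\<sigma> / En)) + 3) = (2 + 3 / sqrt (ln (\<sigma> / En))) * (En / \<sigma> * sqrt (ln (\<sigma> / En)))"
          using elim by simp
        moreover have "capacity \<sigma> En \<le> En / \<sigma> * (2 * sqrt (ln (\<sigma> / En)) + 3)"
          using capacity_low_power_le[of \<sigma> En] elim assms by simp
        ultimately show ?case
          unfolding ereal_less_eq pos_divide_le_eq[OF pos] by (simp only:)
      qed
    qed
    then show ?thesis unfolding lim by simp
  qed
  show "1 / sqrt 2 \<le> Liminf (at_right 0) (\<lambda>En. ereal (?R En))"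
  proof -
    let ?l = "\<lambda>t::real. (t - ln 2 - sqrt (2 * t)) / (sqrt (2 * t) * sqrt t)"
    have "inverse (2 powr (1 / 2)) = 1 / sqrt (2::real)" by (simp add: powr_half_sqrt inverse_eq_divide)
    then have "(?l \<longlongrightarrow> 1 / sqrt 2) at_top" by real_asymp
    from filterlim_compose[OF this L]
    have "((\<lambda>En. ereal (?l (ln (\<sigma> / En)))) \<longlongrightarrow> ereal (1 / sqrt 2)) (at_right 0)" by simp
    then have lim: "Liminf (at_right 0) (\<lambda>En. ereal (?l (ln (\<sigma> / En)))) = ereal (1 / sqrt 2)"
      by (intro lim_imp_Liminf) simp_all
    have "Liminf (at_right 0) (\<lambda>En. ereal (?l (ln (\<sigma> / En)))) \<le> Liminf (at_right 0) (\<lambda>En. ereal (?R En))"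
    proof (rule Liminf_mono)
      show "\<forall>\<^sub>F En in at_right 0. ereal (?l (ln (\<sigma> / En))) \<le> ereal (?R En)"
        using ev
      proof eventually_elim
        case (elim En)
        then have pos: "0 < En / \<sigma> * sqrt (ln (\<sigma> / En))" using assms by auto
        have "?l (ln (\<sigma> / En)) * (En / \<sigma> * sqrt (ln (\<sigma> / En))) =
            En / \<sigma> * (ln (\<sigma> / En) - ln 2 - sqrt (2 * ln (\<sigma> / En))) / sqrt (2 * ln (\<sigma> / En))"
          using pos by (simp add: mult.commute)
        moreover have "En / \<sigma> * (ln (\<sigma> / En) - ln 2 - sqrt (2 * ln (\<sigma> / En))) / sqrt (2 * ln (\<sigma> / En))
            \<le> capacity \<sigma> En"
          using capacity_low_power_ge[of \<sigma> En] elim assms by simp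
        ultimately show ?case
          unfolding ereal_less_eq pos_le_divide_eq[OF pos] by (simp only:)
      qed
    qed
    then show ?thesis unfolding lim by simp
  qed
qed

end
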